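(* Fundamental modal logic is sound and complete with respect to the class of unified, additive modal frames $(X,\vartriangleleft,R)$ in which $\vartriangleleft$ is pseudo-reflexive and pseudo-symmetric: for all $\varphi,\psi\in\mathcal{ML}$, $\varphi\vdash\psi$ in fundamental modal logic iff for every such frame, every valuation on it, and every $x\in X$, if $x\Vdash\varphi$ then $x\Vdash\psi$.
   Context: $\mathcal{ML}$ is the language generated from countably many propositional variables and constants $\bot,\top$ by $\wedge,\vee,\neg,\Box,\Diamond$. Fundamental modal logic is the smallest relation $\vdash\subseteq\mathcal{ML}\times\mathcal{ML}$ such that for all $\varphi,\psi,\chi$: $\varphi\vdash\varphi$; $\varphi\wedge\psi\vdash\varphi$; $\varphi\wedge\psi\vdash\psi$; $\varphi\vdash\varphi\vee\psi$; $\varphi\vdash\psi\vee\varphi$; $\varphi\vdash\neg\neg\varphi$; $\varphi\wedge\neg\varphi\vdash\psi$; if $\varphi\vdash\psi$ and $\psi\vdash\chi$ then $\varphi\vdash\chi$; if $\varphi\vdash\psi$ and $\varphi\vdash\chi$ then $\varphi\vdash\psi\wedge\chi$; if $\varphi\vdash\chi$ and $\psi\vdash\chi$ then $\varphi\vee\psi\vdash\chi$; if $\varphi\vdash\psi$ then $\neg\psi\vdash\neg\varphi$; $\bot\vdash\varphi$ and $\varphi\vdash\top$; $\neg\top\vdash\bot$; $\Box\varphi\wedge\Box\psi\vdash\Box(\varphi\wedge\psi)$; $\Diamond(\varphi\vee\psi)\vdash\Diamond\varphi\vee\Diamond\psi$; $\Diamond\neg\varphi\vdash\neg\Box\varphi$;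 $\top\vdash\Box\top$; $\Diamond\bot\vdash\bot$; if $\varphi\vdash\psi$ then $\Box\varphi\vdash\Box\psi$; if $\varphi\vdash\psi$ then $\Diamond\varphi\vdash\Diamond\psi$. Frames: $X$ nonempty, $\vartriangleleft,R$ binary relations on $X$ ($u\vartriangleright v$ means $v\vartriangleleft u$) satisfying, for all $x,y,z$: (modal) if $xRy$ and $z\vartriangleleft y$, there is $x'\vartriangleleft x$ such that for all $x''$ with $x'\vartriangleleft x''$ there is $y''$ with $x''Ry''$ and $z\vartriangleleft y''$; (additive) if $xRy$ and $y\vartriangleleft z$, there is $x'$ with $x\vartriangleleft x'$ such that for all $x''\vartriangleleft x'$ there is $y''$ with $x''Ry''$ and $y''\vartriangleleft z$. Say $z$ pre-refines $x$ if every $w\vartriangleleft z$ satisfies $w\vartriangleleft x$; $x$ is absurd if there is no $y\vartriangleleft x$. Pseudo-reflexive: every non-absurd $x$ has some $z\vartriangleleft x$ pre-refining $x$. Pseudo-symmetric: for all $x$ and $y\vartriangleleft x$ there is $z\vartriangleleft y$ pre-refining $x$. Semantics: $c_\vartriangleleft(A)=\{x\mid \forall y\vartriangleleft x\ \exists z\vartriangleright y: z\in A\}$; a valuation assigns each variable a $c_\vartriangleleft$-fixpoint. Let $[\![\varphi]\!]=\{x\mid x\Vdash\varphi\}$: $[\![p]\!]=V(p)$; $[\![\top]\!]=X$; $[\![\bot]\!]$ = set of absurd states; $[\![\varphi\wedge\psi]\!]=[\![\varphi]\!]\cap[\![\psi]\!]$; $[\![\varphi\vee\psi]\!]=c_\vartriangleleft([\![\varphi]\!]\cup[\![\psi]\!])$;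 $[\![\neg\varphi]\!]=\{x\mid \forall y\vartriangleleft x,\ y\notin[\![\varphi]\!]\}$; $[\![\Box\varphi]\!]=\{x\mid \forall y(xRy\Rightarrow y\in[\![\varphi]\!])\}$; $[\![\Diamond\varphi]\!]=\{x\mid \forall x'\vartriangleleft x\ \exists y'(x'Ry')\ \exists y\vartriangleright y': y\in[\![\varphi]\!]\}$. *)

theory Defs
  imports Main
begin

datatype fm =
    Var nat
  | Bot
  | Top
  | And fm fm
  | Or fm fm
  | Neg fm
  | Box fm
  | Dia fm

inductive fml :: "fm \<Rightarrow> fm \<Rightarrow> bool"  (infix "\<turnstile>" 50) where
  refl: "\<phi> \<turnstile> \<phi>"
| and_left: "And \<phi> \<psi> \<turnstile> \<phi>"
| and_right: "And \<phi> \<psi> \<turnstile> \<psi>"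
| or_left: "\<phi> \<turnstile> Or \<phi> \<psi>"
| or_right: "\<phi> \<turnstile> Or \<psi> \<phi>"
| double_neg: "\<phi> \<turnstile> Neg (Neg \<phi>)"
| contradiction: "And \<phi> (Neg \<phi>) \<turnstile> \<psi>"
| cut: "\<phi> \<turnstile> \<psi> \<Longrightarrow> \<psi> \<turnstile> \<chi> \<Longrightarrow> \<phi> \<turnstile> \<chi>"
| and_intro: "\<phi> \<turnstile> \<psi> \<Longrightarrow> \<phi> \<turnstile> \<chi> \<Longrightarrow> \<phi> \<turnstile> And \<psi> \<chi>"
| or_elim: "\<phi> \<turnstile> \<chi> \<Longrightarrow> \<psi> \<turnstile> \<chi> \<Longrightarrow> Or \<phi> \<psi> \<turnstile> \<chi>"
| contraposition: "\<phi> \<turnstile> \<psi> \<Longrightarrow> Neg \<psi> \<turnstile> Neg \<phi>"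
| bot: "Bot \<turnstile> \<phi>"
| top: "\<phi> \<turnstile> Top"
| neg_top: "Neg Top \<turnstile> Bot"
| box_and: "And (Box \<phi>) (Box \<psi>) \<turnstile> Box (And \<phi> \<psi>)"
| dia_or: "Dia (Or \<phi> \<psi>) \<turnstile> Or (Dia \<phi>) (Dia \<psi>)"
| dia_neg: "Dia (Neg \<phi>) \<turnstile> Neg (Box \<phi>)"
| box_top: "Top \<turnstile> Box Top"
| dia_bot: "Dia Bot \<turnstile> Bot"
| box_mono: "\<phi> \<turnstile> \<psi> \<Longrightarrow> Box \<phi> \<turnstile> Box \<psi>"
| dia_mono: "\<phi> \<turnstile> \<psi> \<Longrightarrow> Dia \<phi> \<turnstile> Dia \<psi>"

text \<open>
  A frame is a carrier set \<open>X\<close> inside a type, so that frames of every size up to that of the type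
  are covered. The two relations are predicates on the whole type, but only their restriction
  to \<open>X\<close> matters: every quantifier below is relativised to \<open>X\<close>. The frames are unified: the same
  \<open>R\<close> interprets both \<open>Box\<close> and \<open>Dia\<close>.
\<close>

locale two_relations =
  fixes X :: "'a set"
    and tri :: "'a \<Rightarrow> 'a \<Rightarrow> bool"  (infix "\<lhd>" 50)
    and R :: "'a \<Rightarrow> 'a \<Rightarrow> bool"
begin

definition modal_frame :: bool where
  "modal_frame \<longleftrightarrow> X \<noteq> {} \<and>
     (\<forall>x\<in>X. \<forall>y\<in>X. \<forall>z\<in>X. R x y \<and> z \<lhd> y \<longrightarrow>
       (\<exists>x'\<in>X. x' \<lhd> x \<and> (\<forall>x''\<in>X. x' \<lhd> x'' \<longrightarrow> (\<exists>y''\<in>X. R x'' y'' \<and> z \<lhd> y''))))"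

definition additive :: bool where
  "additive \<longleftrightarrow>
     (\<forall>x\<in>X. \<forall>y\<in>X. \<forall>z\<in>X. R x y \<and> y \<lhd> z \<longrightarrow>
       (\<exists>x'\<in>X. x \<lhd> x' \<and> (\<forall>x''\<in>X. x'' \<lhd> x' \<longrightarrow> (\<exists>y''\<in>X. R x'' y'' \<and> y'' \<lhd> z))))"

definition pre_refines :: "'a \<Rightarrow> 'a \<Rightarrow> bool" where
  "pre_refines z x \<longleftrightarrow> (\<forall>w\<in>X. w \<lhd> z \<longrightarrow> w \<lhd> x)"

definition absurd :: "'a \<Rightarrow> bool" where
  "absurd x \<longleftrightarrow> \<not> (\<exists>y\<in>X. y \<lhd> x)"

definition pseudo_reflexive :: bool where
  "pseudo_reflexive \<longleftrightarrow> (\<forall>x\<in>X. \<not> absurd x \<longrightarrow> (\<exists>z\<in>X. z \<lhd> x \<and> pre_refines z x))"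

definition pseudo_symmetric :: bool where
  "pseudo_symmetric \<longleftrightarrow> (\<forall>x\<in>X. \<forall>y\<in>X. y \<lhd> x \<longrightarrow> (\<exists>z\<in>X. z \<lhd> y \<and> pre_refines z x))"

definition cl :: "'a set \<Rightarrow> 'a set" where
  "cl A = {x\<in>X. \<forall>y\<in>X. y \<lhd> x \<longrightarrow> (\<exists>z\<in>X. y \<lhd> z \<and> z \<in> A)}"

text \<open>Since \<open>cl A \<subseteq> X\<close>, fixpoints of \<open>cl\<close> are automatically subsets of \<open>X\<close>.\<close>

definition valuation :: "(nat \<Rightarrow> 'a set) \<Rightarrow> bool" where
  "valuation V \<longleftrightarrow> (\<forall>p. cl (V p) = V p)"

primrec truth_set :: "(nat \<Rightarrow> 'a set) \<Rightarrow> fm \<Rightarrow> 'a set" where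
  "truth_set V (Var p) = V p"
| "truth_set V Bot = {x\<in>X. absurd x}"
| "truth_set V Top = X"
| "truth_set V (And \<phi> \<psi>) = truth_set V \<phi> \<inter> truth_set V \<psi>"
| "truth_set V (Or \<phi> \<psi>) = cl (truth_set V \<phi> \<union> truth_set V \<psi>)"
| "truth_set V (Neg \<phi>) = {x\<in>X. \<forall>y\<in>X. y \<lhd> x \<longrightarrow> y \<notin> truth_set V \<phi>}"
| "truth_set V (Box \<phi>) = {x\<in>X. \<forall>y\<in>X. R x y \<longrightarrow> y \<in> truth_set V \<phi>}"
| "truth_set V (Dia \<phi>) =
     {x\<in>X. \<forall>x'\<in>X. x' \<lhd> x \<longrightarrow> (\<exists>y'\<in>X. R x' y' \<and> (\<exists>y\<in>X. y' \<lhd> y \<and> y \<in> truth_set V \<phi>))}"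

definition forces :: "(nat \<Rightarrow> 'a set) \<Rightarrow> 'a \<Rightarrow> fm \<Rightarrow> bool" where
  "forces V x \<phi> \<longleftrightarrow> x \<in> truth_set V \<phi>"

end

text \<open>
  HOL cannot quantify over types inside a formula, so consequence over the class of frames is
  parameterised by the type from which the carriers are drawn. For completeness the type
  \<open>fm set \<times> fm set\<close> is large enough: it contains all pairs of a filter and an ideal of formulas.
\<close>

definition frame_consequence :: "'a itself \<Rightarrow> fm \<Rightarrow> fm \<Rightarrow> bool" where
  "frame_consequence T \<phi> \<psi> \<longleftrightarrow>
     (\<forall>(X :: 'a set) tri R.
        two_relations.modal_frame X tri R \<and> two_relations.additive X tri R \<and>
        two_relations.pseudo_reflexive X tri \<and> two_relations.pseudo_symmetric X tri \<longrightarrow>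
        (\<forall>V. two_relations.valuation X tri V \<longrightarrow>
          (\<forall>x\<in>X. two_relations.forces X tri R V x \<phi> \<longrightarrow> two_relations.forces X tri R V x \<psi>)))"

end

theory Submission
  imports Defs
begin

text \<open>
  The canonical frame consists of the pairs of a filter \<open>F\<close> and an ideal \<open>I\<close> of formulas such that
  \<open>I\<close> contains the negations of the members of \<open>F\<close>; \<open>F\<close> and \<open>I\<close> may overlap, so that \<open>I\<close> can be the
  set of all formulas. Put \<open>(F, I) \<lhd> (F', I')\<close> iff \<open>I\<close> and \<open>F'\<close> are disjoint, and \<open>(F, I) R (F', I')\<close>
  iff \<open>F'\<close> contains \<open>\<phi>\<close> whenever \<open>Box \<phi> \<in> F\<close> and \<open>I'\<close> contains \<open>\<phi>\<close> whenever \<open>Dia \<phi> \<in> I\<close>.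
  Thanks to \<open>Dia (Neg \<phi>) \<turnstile> Neg (Box \<phi>)\<close>, the pair of preimages of \<open>F\<close> under \<open>Box\<close> and of \<open>I\<close>
  under \<open>Dia\<close> is again a state, so every state has a least successor. This one successor serves as
  witness for both modalities in the truth lemma and for both interaction conditions.
\<close>

section \<open>Soundness\<close>

context two_relations
begin

lemma cl_extensive: "A \<subseteq> X \<Longrightarrow> A \<subseteq> cl A"
  by (auto simp: cl_def)

lemma cl_mono: "A \<subseteq> B \<Longrightarrow> cl A \<subseteq> cl B"
  unfolding cl_def by blast

lemma cl_idem: "cl (cl A) = cl A"
  unfolding cl_def by blast

text \<open>If \<open>x\<close> is in the closure and \<open>y \<lhd> x\<close>, some
  \<open>z\<close> in the set has \<open>y \<lhd> z\<close>, and this \<open>z\<close> yields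
  \<open>P y\<close>. Negations and diamonds have this shape, so they denote fixpoints whatever
  their arguments denote.\<close>

lemma cl_upper_fixpoint: "cl {x\<in>X. \<forall>y\<in>X. y \<lhd> x \<longrightarrow> P y} = {x\<in>X. \<forall>y\<in>X. y \<lhd> x \<longrightarrow> P y}"
  unfolding cl_def by blast

lemma cl_memI: "cl A = A \<Longrightarrow> x \<in> X \<Longrightarrow> (\<And>y. y \<in> X \<Longrightarrow> y \<lhd> x \<Longrightarrow> \<exists>z\<in>X. y \<lhd> z \<and> z \<in> A) \<Longrightarrow> x \<in> A"
  unfolding cl_def by blast

lemma cl_fixpoint_absurd:
  assumes "cl A = A" "x \<in> X" "absurd x"
  shows "x \<in> A"
proof -
  have "x \<in> cl A"
    using assms(2,3) by (simp add: cl_def absurd_def)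
  with assms(1) show ?thesis
    by simp
qed

text \<open>Whether a point of \<open>X\<close> is in \<open>cl A\<close> depends only on its set of
  \<open>\<lhd>\<close>-predecessors, and shrinking that set preserves membership.\<close>

lemma cl_fixpoint_pre_refines:
  assumes A: "cl A = A" and "x \<in> A" "z \<in> X" "pre_refines z x"
  shows "z \<in> A"
proof -
  have "x \<in> cl A"
    using A \<open>x \<in> A\<close> by simp
  with \<open>z \<in> X\<close> \<open>pre_refines z x\<close> have "z \<in> cl A"
    by (simp add: cl_def pre_refines_def)
  with A show ?thesis
    by simp
qed

lemma cl_box:
  assumes modal_frame and A: "cl A = A"
  shows "cl {x\<in>X. \<forall>y\<in>X. R x y \<longrightarrow> y \<in> A} = {x\<in>X. \<forall>y\<in>X. R x y \<longrightarrow> y \<in> A}" (is "cl ?B = ?B")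
proof
  show "?B \<subseteq> cl ?B"
    by (rule cl_extensive) blast
  show "cl ?B \<subseteq> ?B"
  proof
    fix x assume x: "x \<in> cl ?B"
    then have xX: "x \<in> X"
      by (simp add: cl_def)
    have "y \<in> A" if y: "y \<in> X" "R x y" for y
    proof (rule cl_memI[OF A y(1)])
      \<comment> \<open>The modal condition turns \<open>z \<lhd> y\<close> into some
        \<open>x' \<lhd> x\<close>. As \<open>x\<close> is in the closure, \<open>x'\<close> is
        below some \<open>x''\<close> in \<open>?B\<close>, whose successor \<open>y''\<close> lies
        in \<open>A\<close>.\<close>
      fix z assume z: "z \<in> X" "z \<lhd> y"
      from \<open>modal_frame\<close> xX y z
      have "\<exists>x'\<in>X. x' \<lhd> x \<and> (\<forall>x''\<in>X. x' \<lhd> x'' \<longrightarrow> (\<exists>y''\<in>X. R x'' y'' \<and> z \<lhd> y''))"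
        unfolding modal_frame_def by simp
      then obtain x' where x': "x' \<in> X" "x' \<lhd> x"
        and *: "\<And>x''. x'' \<in> X \<Longrightarrow> x' \<lhd> x'' \<Longrightarrow> \<exists>y''\<in>X. R x'' y'' \<and> z \<lhd> y''"
        by blast
      from x x' obtain x'' where "x'' \<in> X" "x' \<lhd> x''" "x'' \<in> ?B"
        unfolding cl_def by blast
      with * show "\<exists>y''\<in>X. z \<lhd> y'' \<and> y'' \<in> A"
        by blast
    qed
    with xX show "x \<in> ?B"
      by blast
  qed
qed

text \<open>Among compound formulas only conjunction and box need the induction hypothesis. Being a
  fixpoint is what later carries truth to pre-refining points and to absurd ones.\<close>

lemma cl_truth_set:
  assumes modal_frame "valuation V"
  shows "cl (truth_set V \<phi>) = truth_set V \<phi>"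
proof (induction \<phi>)
  case (Var p)
  then show ?case
    using assms by (simp add: valuation_def)
next
  case Bot
  then show ?case
    by (auto simp: cl_def absurd_def)
next
  case Top
  then show ?case
    by (auto simp: cl_def)
next
  case (And \<phi> \<psi>)
  have "cl (truth_set V (And \<phi> \<psi>)) \<subseteq> cl (truth_set V \<phi>) \<inter> cl (truth_set V \<psi>)"
    by (simp add: cl_mono)
  moreover have "truth_set V \<phi> \<subseteq> X"
    using And(1) unfolding cl_def by blast
  then have "truth_set V (And \<phi> \<psi>) \<subseteq> cl (truth_set V (And \<phi> \<psi>))"
    by (intro cl_extensive) auto
  ultimately show ?case
    using And by auto
next
  case (Or \<phi> \<psi>)
  then show ?case
    by (simp add: cl_idem)
next
  case (Neg \<phi>)
  have "cl {x\<in>X. \<forall>y\<in>X. y \<lhd> x \<longrightarrow> y \<notin> truth_set V \<phi>} = {x\<in>X. \<forall>y\<in>X. y \<lhd> x \<longrightarrow> y \<notin> truth_set V \<phi>}"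
    by (rule cl_upper_fixpoint)
  then show ?case
    by simp
next
  case (Box \<phi>)
  then show ?case
    using cl_box[OF assms(1)] by simp
next
  case (Dia \<phi>)
  let ?P = "\<lambda>x'. \<exists>y'\<in>X. R x' y' \<and> (\<exists>y\<in>X. y' \<lhd> y \<and> y \<in> truth_set V \<phi>)"
  have "cl {x\<in>X. \<forall>x'\<in>X. x' \<lhd> x \<longrightarrow> ?P x'} = {x\<in>X. \<forall>x'\<in>X. x' \<lhd> x \<longrightarrow> ?P x'}"
    by (rule cl_upper_fixpoint)
  then show ?case
    by simp
qed

text \<open>The closure supplies \<open>z\<close> in \<open>C\<close> with
  \<open>y' \<lhd> z\<close>, and additivity is applied to that pair. As \<open>z\<close> is fixed
  before \<open>v\<close>, for a union \<open>C\<close> of two truth sets the point \<open>u\<close>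
  satisfies the diamond of a single disjunct.\<close>

lemma additive_cl_witness:
  assumes additive and x: "x \<in> X"
    and y: "y' \<in> X" "R x y'" "y \<in> X" "y' \<lhd> y" "y \<in> cl C"
  shows "\<exists>u\<in>X. \<exists>z\<in>C. x \<lhd> u \<and> (\<forall>v\<in>X. v \<lhd> u \<longrightarrow> (\<exists>w\<in>X. R v w \<and> w \<lhd> z))"
proof -
  from y obtain z where z: "z \<in> X" "y' \<lhd> z" "z \<in> C"
    by (auto simp: cl_def)
  moreover from \<open>additive\<close> x y(1,2) z(1,2)
  have "\<exists>u\<in>X. x \<lhd> u \<and> (\<forall>v\<in>X. v \<lhd> u \<longrightarrow> (\<exists>w\<in>X. R v w \<and> w \<lhd> z))"
    unfolding additive_def by simp
  ultimately show ?thesis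
    by blast
qed

lemma soundness:
  assumes modal_frame additive pseudo_reflexive pseudo_symmetric "valuation V"
    and "\<phi> \<turnstile> \<psi>"
  shows "truth_set V \<phi> \<subseteq> truth_set V \<psi>"
proof -
  note fixpoint = cl_truth_set[OF \<open>modal_frame\<close> \<open>valuation V\<close>]
  have sub: "truth_set V \<chi> \<subseteq> X" for \<chi>
    using fixpoint[of \<chi>] unfolding cl_def by blast
  from \<open>\<phi> \<turnstile> \<psi>\<close> show ?thesis
  proof induction
    case (or_left \<phi> \<psi>)
    have "truth_set V \<phi> \<union> truth_set V \<psi> \<subseteq> cl (truth_set V \<phi> \<union> truth_set V \<psi>)"
      using sub by (intro cl_extensive) auto
    then show ?case by simp
  next
    case (or_right \<phi> \<psi>)
    have "truth_set V \<psi> \<union> truth_set V \<phi> \<subseteq> cl (truth_set V \<psi> \<union> truth_set V \<phi>)"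
      using sub by (intro cl_extensive) auto
    then show ?case by simp
  next
    case (double_neg \<phi>)
    show ?case
    proof
      fix x assume x: "x \<in> truth_set V \<phi>"
      then have xX: "x \<in> X"
        using sub by blast
      \<comment> \<open>Pseudo-symmetry gives a predecessor of \<open>y\<close> that pre-refines
        \<open>x\<close>; it inherits \<open>\<phi>\<close> and so refutes \<open>Neg \<phi>\<close>
        at \<open>y\<close>.\<close>
      have "y \<notin> truth_set V (Neg \<phi>)" if y: "y \<in> X" "y \<lhd> x" for y
      proof -
        from \<open>pseudo_symmetric\<close> xX y obtain z where "z \<in> X" "z \<lhd> y" "pre_refines z x"
          unfolding pseudo_symmetric_def by blast
        with cl_fixpoint_pre_refines[OF fixpoint x] show ?thesis
          by auto
      qed
      with xX show "x \<in> truth_set V (Neg (Neg \<phi>))"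
        by (subst truth_set.simps) blast
    qed
  next
    case (contradiction \<phi> \<psi>)
    show ?case
    proof
      fix x assume x: "x \<in> truth_set V (And \<phi> (Neg \<phi>))"
      then have xX: "x \<in> X"
        using sub by blast
      \<comment> \<open>By pseudo-reflexivity a non-absurd \<open>x\<close> would have a predecessor
        inheriting \<open>\<phi>\<close>, against \<open>Neg \<phi>\<close> at
        \<open>x\<close>.\<close>
      have "absurd x"
      proof (rule ccontr)
        assume "\<not> absurd x"
        with \<open>pseudo_reflexive\<close> xX obtain z where "z \<in> X" "z \<lhd> x" "pre_refines z x"
          unfolding pseudo_reflexive_def by blast
        with cl_fixpoint_pre_refines[OF fixpoint[of \<phi>], of x z] x show False
          by auto
      qed
      then show "x \<in> truth_set V \<psi>"
        using cl_fixpoint_absurd[OF fixpoint xX] by blast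
    qed
  next
    case (or_elim \<phi> \<chi> \<psi>)
    then have "cl (truth_set V \<phi> \<union> truth_set V \<psi>) \<subseteq> cl (truth_set V \<chi>)"
      by (intro cl_mono) auto
    then show ?case
      using fixpoint by simp
  next
    case (bot \<phi>)
    then show ?case
      using cl_fixpoint_absurd[OF fixpoint] by auto
  next
    case (top \<phi>)
    then show ?case
      using sub by simp
  next
    case neg_top
    then show ?case
      by (auto simp: absurd_def)
  next
    case (dia_or \<phi> \<psi>)
    show ?case
    proof
      fix x assume x: "x \<in> truth_set V (Dia (Or \<phi> \<psi>))"
      then have xX: "x \<in> X"
        using sub by blast
      have "\<exists>u\<in>X. x' \<lhd> u \<and> u \<in> truth_set V (Dia \<phi>) \<union> truth_set V (Dia \<psi>)"
        if x': "x' \<in> X" "x' \<lhd> x" for x'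
      proof -
        from x x' obtain y' y where "y' \<in> X" "R x' y'" "y \<in> X" "y' \<lhd> y"
          "y \<in> cl (truth_set V \<phi> \<union> truth_set V \<psi>)"
          by auto
        from additive_cl_witness[OF \<open>additive\<close> x'(1) this]
        obtain u z where u: "u \<in> X" "x' \<lhd> u" "z \<in> truth_set V \<phi> \<union> truth_set V \<psi>"
          and *: "\<forall>v\<in>X. v \<lhd> u \<longrightarrow> (\<exists>w\<in>X. R v w \<and> w \<lhd> z)"
          by blast
        have dia: "u \<in> truth_set V (Dia \<chi>)" if "z \<in> truth_set V \<chi>" for \<chi>
        proof -
          have "z \<in> X"
            using that sub by blast
          with that u(1) * show ?thesis
            by (simp only: truth_set.simps mem_Collect_eq) blast
        qed
        from u(3) have "u \<in> truth_set V (Dia \<phi>) \<union> truth_set V (Dia \<psi>)"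
          using dia by blast
        with u(1,2) show ?thesis
          by blast
      qed
      with xX show "x \<in> truth_set V (Or (Dia \<phi>) (Dia \<psi>))"
        by (simp only: truth_set.simps(5) cl_def mem_Collect_eq) blast
    qed
  next
    case dia_bot
    then show ?case
      by (auto simp: absurd_def)
  next
    case (dia_mono \<phi> \<psi>)
    then show ?case
      by (simp only: truth_set.simps) blast
  next
    case (contraposition \<phi> \<psi>)
    then show ?case
      by (simp only: truth_set.simps) blast
  next
    case (box_mono \<phi> \<psi>)
    then show ?case
      by (simp only: truth_set.simps) blast
  next
    case (box_and \<phi> \<psi>)
    then show ?case
      by (simp only: truth_set.simps) blast
  next
    \<comment> \<open>One \<open>R\<close> serves both modalities: the successor \<open>y'\<close>
      of \<open>x'\<close> lies below a point satisfying \<open>Neg \<phi>\<close>, so it fails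
      \<open>\<phi>\<close>, and \<open>x'\<close> fails \<open>Box \<phi>\<close>.\<close>
    case (dia_neg \<phi>)
    then show ?case
      by (simp only: truth_set.simps) blast
  qed simp_all
qed

end

lemma frame_soundness:
  assumes "\<phi> \<turnstile> \<psi>"
  shows "frame_consequence TYPE('a) \<phi> \<psi>"
  unfolding frame_consequence_def two_relations.forces_def
  using two_relations.soundness[OF _ _ _ _ _ assms] by blast

section \<open>Filters and ideals of formulas\<close>

definition fm_filter :: "fm set \<Rightarrow> bool" where
  "fm_filter F \<longleftrightarrow> Top \<in> F \<and> (\<forall>\<phi>\<in>F. \<forall>\<psi>. \<phi> \<turnstile> \<psi> \<longrightarrow> \<psi> \<in> F) \<and> (\<forall>\<phi>\<in>F. \<forall>\<psi>\<in>F. And \<phi> \<psi> \<in> F)"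

definition fm_ideal :: "fm set \<Rightarrow> bool" where
  "fm_ideal I \<longleftrightarrow> Bot \<in> I \<and> (\<forall>\<phi>\<in>I. \<forall>\<psi>. \<psi> \<turnstile> \<phi> \<longrightarrow> \<psi> \<in> I) \<and> (\<forall>\<phi>\<in>I. \<forall>\<psi>\<in>I. Or \<phi> \<psi> \<in> I)"

lemma fm_filterD:
  assumes "fm_filter F"
  shows "Top \<in> F" "\<phi> \<in> F \<Longrightarrow> \<phi> \<turnstile> \<psi> \<Longrightarrow> \<psi> \<in> F" "\<phi> \<in> F \<Longrightarrow> \<psi> \<in> F \<Longrightarrow> And \<phi> \<psi> \<in> F"
  using assms unfolding fm_filter_def by blast+

lemma fm_idealD:
  assumes "fm_ideal I"
  shows "Bot \<in> I" "\<phi> \<in> I \<Longrightarrow> \<psi> \<turnstile> \<phi> \<Longrightarrow> \<psi> \<in> I" "\<phi> \<in> I \<Longrightarrow> \<psi> \<in> I \<Longrightarrow> Or \<phi> \<psi> \<in> I"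
  using assms unfolding fm_ideal_def by blast+

lemma fm_filter_up: "fm_filter {\<psi>. \<phi> \<turnstile> \<psi>}"
  unfolding fm_filter_def by (auto intro: fml.intros)

lemma fm_ideal_down: "fm_ideal {\<psi>. \<psi> \<turnstile> \<phi>}"
  unfolding fm_ideal_def by (auto intro: fml.intros)

lemma fm_ideal_UNIV: "fm_ideal UNIV"
  unfolding fm_ideal_def by blast

text \<open>\<open>f\<close> need not preserve conjunctions: by monotonicity
  \<open>f (And \<phi> \<phi>')\<close> is below both \<open>f \<phi>\<close> and
  \<open>f \<phi>'\<close>. The case \<open>f = Dia\<close> serves additivity; the dual for ideals,
  with \<open>f = Box\<close>, serves the modal condition.\<close>

lemma fm_filter_image:
  assumes F: "fm_filter F" and mono: "\<And>\<phi> \<psi>. \<phi> \<turnstile> \<psi> \<Longrightarrow> f \<phi> \<turnstile> f \<psi>"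
  shows "fm_filter {\<psi>. \<exists>\<phi>\<in>F. f \<phi> \<turnstile> \<psi>}"
proof -
  have "\<exists>\<phi>\<in>F. f \<phi> \<turnstile> And \<psi> \<psi>'" if "\<phi> \<in> F" "f \<phi> \<turnstile> \<psi>" "\<phi>' \<in> F" "f \<phi>' \<turnstile> \<psi>'" for \<psi> \<psi>' \<phi> \<phi>'
    using that fm_filterD(3)[OF F, of \<phi> \<phi>'] mono[OF and_left, of \<phi> \<phi>'] mono[OF and_right, of \<phi> \<phi>']
    by (blast intro: and_intro cut)
  then show ?thesis
    unfolding fm_filter_def using fm_filterD(1)[OF F] by (blast intro: fml.top cut)
qed

lemma fm_ideal_image:
  assumes I: "fm_ideal I" and mono: "\<And>\<phi> \<psi>. \<phi> \<turnstile> \<psi> \<Longrightarrow> f \<phi> \<turnstile> f \<psi>"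
  shows "fm_ideal {\<psi>. \<exists>\<phi>\<in>I. \<psi> \<turnstile> f \<phi>}"
proof -
  have "\<exists>\<phi>\<in>I. Or \<psi> \<psi>' \<turnstile> f \<phi>" if "\<phi> \<in> I" "\<psi> \<turnstile> f \<phi>" "\<phi>' \<in> I" "\<psi>' \<turnstile> f \<phi>'" for \<psi> \<psi>' \<phi> \<phi>'
    using that fm_idealD(3)[OF I, of \<phi> \<phi>'] mono[OF or_left, of \<phi> \<phi>'] mono[OF or_right, of \<phi>' \<phi>]
    by (blast intro: or_elim cut)
  then show ?thesis
    unfolding fm_ideal_def using fm_idealD(1)[OF I] by (blast intro: fml.bot cut)
qed

lemma fm_ideal_neg_image:
  assumes F: "fm_filter F"
  shows "fm_ideal {\<psi>. \<exists>\<phi>\<in>F. \<psi> \<turnstile> Neg \<phi>}"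
proof -
  have "\<exists>\<phi>\<in>F. Or \<psi> \<psi>' \<turnstile> Neg \<phi>" if "\<phi> \<in> F" "\<psi> \<turnstile> Neg \<phi>" "\<phi>' \<in> F" "\<psi>' \<turnstile> Neg \<phi>'" for \<psi> \<psi>' \<phi> \<phi>'
    using that fm_filterD(3)[OF F, of \<phi> \<phi>']
      contraposition[OF and_left, of \<phi> \<phi>'] contraposition[OF and_right, of \<phi>' \<phi>]
    by (blast intro: or_elim cut)
  then show ?thesis
    unfolding fm_ideal_def using fm_filterD(1)[OF F] by (blast intro: fml.bot cut)
qed

lemma fm_filter_box_preimage:
  assumes F: "fm_filter F"
  shows "fm_filter {\<phi>. Box \<phi> \<in> F}"
  unfolding fm_filter_def
proof (intro conjI ballI allI impI; unfold mem_Collect_eq)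
  show "Box Top \<in> F"
    by (rule fm_filterD(2)[OF F fm_filterD(1)[OF F] box_top])
  show "Box \<psi> \<in> F" if "Box \<phi> \<in> F" "\<phi> \<turnstile> \<psi>" for \<phi> \<psi>
    by (rule fm_filterD(2)[OF F that(1) box_mono[OF that(2)]])
  show "Box (And \<phi> \<psi>) \<in> F" if "Box \<phi> \<in> F" "Box \<psi> \<in> F" for \<phi> \<psi>
    by (rule fm_filterD(2)[OF F fm_filterD(3)[OF F that] box_and])
qed

lemma fm_ideal_dia_preimage:
  assumes I: "fm_ideal I"
  shows "fm_ideal {\<phi>. Dia \<phi> \<in> I}"
  unfolding fm_ideal_def
proof (intro conjI ballI allI impI; unfold mem_Collect_eq)
  show "Dia Bot \<in> I"
    by (rule fm_idealD(2)[OF I fm_idealD(1)[OF I] dia_bot])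
  show "Dia \<psi> \<in> I" if "Dia \<phi> \<in> I" "\<psi> \<turnstile> \<phi>" for \<phi> \<psi>
    by (rule fm_idealD(2)[OF I that(1) dia_mono[OF that(2)]])
  show "Dia (Or \<phi> \<psi>) \<in> I" if "Dia \<phi> \<in> I" "Dia \<psi> \<in> I" for \<phi> \<psi>
    by (rule fm_idealD(2)[OF I fm_idealD(3)[OF I that] dia_or])
qed

section \<open>The canonical frame\<close>

definition canon_states :: "(fm set \<times> fm set) set" where
  "canon_states = {(F, I). fm_filter F \<and> fm_ideal I \<and> (\<forall>\<phi>\<in>F. Neg \<phi> \<in> I)}"

definition canon_tri :: "fm set \<times> fm set \<Rightarrow> fm set \<times> fm set \<Rightarrow> bool" where
  "canon_tri x y \<longleftrightarrow> snd x \<inter> fst y = {}"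

definition canon_R :: "fm set \<times> fm set \<Rightarrow> fm set \<times> fm set \<Rightarrow> bool" where
  "canon_R x y \<longleftrightarrow> {\<phi>. Box \<phi> \<in> fst x} \<subseteq> fst y \<and> {\<phi>. Dia \<phi> \<in> snd x} \<subseteq> snd y"

definition canon_succ :: "fm set \<times> fm set \<Rightarrow> fm set \<times> fm set" where
  "canon_succ x = ({\<phi>. Box \<phi> \<in> fst x}, {\<phi>. Dia \<phi> \<in> snd x})"

interpretation canon: two_relations canon_states canon_tri canon_R .

lemma canon_stateD:
  assumes "x \<in> canon_states"
  shows "fm_filter (fst x)" "fm_ideal (snd x)" "\<phi> \<in> fst x \<Longrightarrow> Neg \<phi> \<in> snd x"
  using assms by (auto simp: canon_states_def)

lemma canon_succ_state:
  assumes "x \<in> canon_states"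
  shows "canon_succ x \<in> canon_states"
proof -
  have "Dia (Neg \<phi>) \<in> snd x" if "Box \<phi> \<in> fst x" for \<phi>
    using fm_idealD(2)[OF canon_stateD(2)[OF assms] canon_stateD(3)[OF assms that] dia_neg] .
  then show ?thesis
    using fm_filter_box_preimage fm_ideal_dia_preimage canon_stateD(1,2)[OF assms]
    by (simp add: canon_states_def canon_succ_def)
qed

lemma canon_R_succ: "canon_R x (canon_succ x)"
  by (simp add: canon_R_def canon_succ_def)

text \<open>On the right of \<open>canon_tri\<close> only the filter matters, so the ideal may be
  everything, which trivialises the condition on negations.\<close>

lemma filter_state: "fm_filter F \<Longrightarrow> (F, UNIV) \<in> canon_states"
  by (simp add: canon_states_def fm_ideal_UNIV)

text \<open>On the left of \<open>canon_tri\<close> only the ideal matters, so the filter is the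
  least one. The negation of a theorem entails \<open>Neg Top\<close>, hence \<open>Bot\<close>, and
  so lies in every ideal.\<close>

lemma ideal_state:
  assumes "fm_ideal I"
  shows "({\<phi>. Top \<turnstile> \<phi>}, I) \<in> canon_states"
proof -
  have "Neg \<phi> \<in> I" if "Top \<turnstile> \<phi>" for \<phi>
    using fm_idealD[OF assms] contraposition[OF that] neg_top by blast
  with assms show ?thesis
    by (simp add: canon_states_def fm_filter_up)
qed

text \<open>This is the least ideal that can accompany \<open>F\<close>, so it has the best chance
  of avoiding a given filter. The state pre-refines every state with filter \<open>F\<close>, since
  \<open>canon_tri\<close> reads only the filter of its right argument.\<close>

lemma neg_image_state:
  assumes "fm_filter F"
  shows "(F, {\<psi>. \<exists>\<phi>\<in>F. \<psi> \<turnstile> Neg \<phi>}) \<in> canon_states"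
  using assms fm_ideal_neg_image[OF assms] by (auto simp: canon_states_def intro: fml.refl)

lemma canon_absurd_iff:
  assumes "x \<in> canon_states"
  shows "canon.absurd x \<longleftrightarrow> Bot \<in> fst x"
proof
  assume "canon.absurd x"
  then have "\<not> canon_tri ({\<phi>. Top \<turnstile> \<phi>}, {\<phi>. \<phi> \<turnstile> Bot}) x"
    using ideal_state[OF fm_ideal_down] by (auto simp: canon.absurd_def)
  then show "Bot \<in> fst x"
    using fm_filterD(2)[OF canon_stateD(1)[OF assms]] by (auto simp: canon_tri_def)
next
  assume "Bot \<in> fst x"
  then show "canon.absurd x"
    using fm_idealD(1)[OF canon_stateD(2)] unfolding canon.absurd_def canon_tri_def by blast
qed

section \<open>The frame conditions of the canonical frame\<close>

lemma canon_modal_frame: "canon.modal_frame"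
  unfolding canon.modal_frame_def
proof (intro conjI ballI impI)
  show "canon_states \<noteq> {}"
    using filter_state[OF fm_filter_up] by blast
next
  fix x y z
  assume x: "x \<in> canon_states" and z: "z \<in> canon_states" and xyz: "canon_R x y \<and> canon_tri z y"
  \<comment> \<open>The ideal is generated by \<open>Box \<phi>\<close> for \<open>\<phi>\<close> in
    \<open>snd z\<close>: avoiding it forces \<open>Box \<phi> \<notin> fst x''\<close> for all
    these \<open>\<phi>\<close>, that is, \<open>z\<close> is below
    \<open>canon_succ x''\<close>.\<close>
  define x' where "x' = ({\<phi>. Top \<turnstile> \<phi>}, {\<psi>. \<exists>\<phi>\<in>snd z. \<psi> \<turnstile> Box \<phi>})"
  have x': "x' \<in> canon_states"
    unfolding x'_def by (intro ideal_state fm_ideal_image canon_stateD(2)[OF z] box_mono)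
  have x'x: "canon_tri x' x"
    using xyz fm_filterD(2)[OF canon_stateD(1)[OF x]]
    unfolding canon_tri_def canon_R_def x'_def by fastforce
  have "canon_tri z (canon_succ x'')" if "canon_tri x' x''" for x''
    using that unfolding canon_tri_def canon_succ_def x'_def by (auto intro: fml.refl)
  with x' x'x show "\<exists>x'\<in>canon_states. canon_tri x' x \<and>
      (\<forall>x''\<in>canon_states. canon_tri x' x'' \<longrightarrow> (\<exists>y''\<in>canon_states. canon_R x'' y'' \<and> canon_tri z y''))"
    using canon_succ_state canon_R_succ by blast
qed

lemma canon_additive: "canon.additive"
  unfolding canon.additive_def
proof (intro ballI impI)
  fix x y z
  assume x: "x \<in> canon_states" and z: "z \<in> canon_states" and xyz: "canon_R x y \<and> canon_tri y z"
  \<comment> \<open>Dually, the filter is generated by \<open>Dia \<phi>\<close> for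
    \<open>\<phi>\<close> in \<open>fst z\<close>, so that \<open>canon_succ x''\<close> is below
    \<open>z\<close> whenever \<open>x''\<close> is below \<open>x'\<close>.\<close>
  define x' where "x' = ({\<psi>. \<exists>\<phi>\<in>fst z. Dia \<phi> \<turnstile> \<psi>}, UNIV :: fm set)"
  have x': "x' \<in> canon_states"
    unfolding x'_def by (intro filter_state fm_filter_image canon_stateD(1)[OF z] dia_mono)
  have xx': "canon_tri x x'"
    using xyz fm_idealD(2)[OF canon_stateD(2)[OF x]]
    unfolding canon_tri_def canon_R_def x'_def by fastforce
  have "canon_tri (canon_succ x'') z" if "canon_tri x'' x'" for x''
    using that unfolding canon_tri_def canon_succ_def x'_def by (auto intro: fml.refl)
  with x' xx' show "\<exists>x'\<in>canon_states. canon_tri x x' \<and>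
      (\<forall>x''\<in>canon_states. canon_tri x'' x' \<longrightarrow> (\<exists>y''\<in>canon_states. canon_R x'' y'' \<and> canon_tri y'' z))"
    using canon_succ_state canon_R_succ by blast
qed

lemma canon_pseudo_reflexive: "canon.pseudo_reflexive"
  unfolding canon.pseudo_reflexive_def
proof (intro ballI impI)
  fix x
  assume x: "x \<in> canon_states" and "\<not> canon.absurd x"
  then have Bot: "Bot \<notin> fst x"
    by (simp add: canon_absurd_iff)
  let ?z = "(fst x, {\<psi>. \<exists>\<phi>\<in>fst x. \<psi> \<turnstile> Neg \<phi>})"
  have "False" if "\<psi> \<in> fst x" "\<phi> \<in> fst x" "\<psi> \<turnstile> Neg \<phi>" for \<phi> \<psi>
  proof -
    note F = fm_filterD[OF canon_stateD(1)[OF x]]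
    have "And \<phi> (Neg \<phi>) \<in> fst x"
      using that by (intro F(3) F(2)[of \<psi> "Neg \<phi>"])
    then have "Bot \<in> fst x"
      by (rule F(2)) (rule contradiction)
    with Bot show False ..
  qed
  then have "canon_tri ?z x"
    by (auto simp: canon_tri_def)
  then show "\<exists>z\<in>canon_states. canon_tri z x \<and> canon.pre_refines z x"
    using neg_image_state[OF canon_stateD(1)[OF x]]
    by (intro bexI[of _ ?z]) (auto simp: canon.pre_refines_def canon_tri_def)
qed

lemma canon_pseudo_symmetric: "canon.pseudo_symmetric"
  unfolding canon.pseudo_symmetric_def
proof (intro ballI impI)
  fix x y
  assume x: "x \<in> canon_states" and y: "y \<in> canon_states" and yx: "canon_tri y x"
  let ?z = "(fst x, {\<psi>. \<exists>\<phi>\<in>fst x. \<psi> \<turnstile> Neg \<phi>})"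
  have "False" if "\<psi> \<in> fst y" "\<phi> \<in> fst x" "\<psi> \<turnstile> Neg \<phi>" for \<phi> \<psi>
  proof -
    \<comment> \<open>Double negation introduction makes
      \<open>\<phi> \<turnstile> Neg \<psi>\<close> follow from
      \<open>\<psi> \<turnstile> Neg \<phi>\<close>. The state condition on \<open>y\<close> puts
      \<open>Neg \<psi>\<close>, hence \<open>\<phi>\<close>, into \<open>snd y\<close>, which then
      meets \<open>fst x\<close>.\<close>
    have "\<phi> \<turnstile> Neg \<psi>"
      using contraposition[OF that(3)] double_neg cut by blast
    then have "\<phi> \<in> snd y"
      using canon_stateD(3)[OF y that(1)] fm_idealD(2)[OF canon_stateD(2)[OF y]] by blast
    with that yx show False
      by (auto simp: canon_tri_def)
  qed
  then have "canon_tri ?z y"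
    by (auto simp: canon_tri_def)
  then show "\<exists>z\<in>canon_states. canon_tri z y \<and> canon.pre_refines z x"
    using neg_image_state[OF canon_stateD(1)[OF x]]
    by (intro bexI[of _ ?z]) (auto simp: canon.pre_refines_def canon_tri_def)
qed

section \<open>The truth lemma and completeness\<close>

definition canon_val :: "nat \<Rightarrow> (fm set \<times> fm set) set" where
  "canon_val p = {x\<in>canon_states. Var p \<in> fst x}"

lemma mem_canon_cl_iff:
  assumes "x \<in> canon_states" "A \<subseteq> {z. \<phi> \<in> fst z}"
    and "\<And>y. y \<in> canon_states \<Longrightarrow> \<phi> \<notin> snd y \<Longrightarrow> \<exists>z\<in>canon_states. canon_tri y z \<and> z \<in> A"
  shows "x \<in> canon.cl A \<longleftrightarrow> \<phi> \<in> fst x"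
proof
  assume cl: "x \<in> canon.cl A"
  show "\<phi> \<in> fst x"
  proof (rule ccontr)
    \<comment> \<open>This state is below exactly the states whose filter omits
      \<open>\<phi>\<close>; hence it is below \<open>x\<close> but below no member of
      \<open>A\<close>.\<close>
    let ?y = "({\<psi>. Top \<turnstile> \<psi>}, {\<psi>. \<psi> \<turnstile> \<phi>})"
    assume "\<phi> \<notin> fst x"
    then have "canon_tri ?y x"
      using fm_filterD(2)[OF canon_stateD(1)[OF assms(1)]] by (auto simp: canon_tri_def)
    with cl ideal_state[OF fm_ideal_down] obtain z where "canon_tri ?y z" "z \<in> A"
      by (fastforce simp: canon.cl_def)
    with assms(2) show False
      by (auto simp: canon_tri_def intro: fml.refl)
  qed
next
  assume "\<phi> \<in> fst x"
  then have "\<phi> \<notin> snd y" if "canon_tri y x" for y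
    using that by (auto simp: canon_tri_def)
  with assms show "x \<in> canon.cl A"
    unfolding canon.cl_def by blast
qed

lemma canon_tri_up:
  assumes "y \<in> canon_states" "\<phi> \<notin> snd y"
  shows "canon_tri y ({\<psi>. \<phi> \<turnstile> \<psi>}, UNIV)"
  using assms fm_idealD(2)[OF canon_stateD(2)[OF assms(1)]] by (auto simp: canon_tri_def)

lemma canon_valuation: "canon.valuation canon_val"
proof -
  have "x \<in> canon.cl (canon_val p) \<longleftrightarrow> Var p \<in> fst x" if "x \<in> canon_states" for x p
  proof (rule mem_canon_cl_iff[OF that])
    show "\<exists>z\<in>canon_states. canon_tri y z \<and> z \<in> canon_val p"
      if "y \<in> canon_states" "Var p \<notin> snd y" for y
      using canon_tri_up[OF that] filter_state[OF fm_filter_up]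
      by (intro bexI[of _ "({\<psi>. Var p \<turnstile> \<psi>}, UNIV)"]) (auto simp: canon_val_def intro: fml.refl)
  qed (auto simp: canon_val_def)
  then show ?thesis
    unfolding canon.valuation_def by (auto simp: canon_val_def) (auto simp: canon.cl_def)
qed

lemma truth_lemma: "canon.truth_set canon_val \<phi> = {x\<in>canon_states. \<phi> \<in> fst x}"
proof (induction \<phi>)
  case (Var p)
  then show ?case
    by (simp add: canon_val_def)
next
  case Bot
  then show ?case
    by (auto simp: canon_absurd_iff)
next
  case Top
  then show ?case
    using fm_filterD(1)[OF canon_stateD(1)] by auto
next
  case (And \<phi> \<psi>)
  then show ?case
    using fm_filterD(2,3)[OF canon_stateD(1)] and_left and_right by auto
next
  case (Or \<phi> \<psi>)
  let ?A = "{x\<in>canon_states. \<phi> \<in> fst x} \<union> {x\<in>canon_states. \<psi> \<in> fst x}"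
  have "x \<in> canon.cl ?A \<longleftrightarrow> Or \<phi> \<psi> \<in> fst x" if "x \<in> canon_states" for x
  proof (rule mem_canon_cl_iff[OF that])
    show "?A \<subseteq> {z. Or \<phi> \<psi> \<in> fst z}"
      using fm_filterD(2)[OF canon_stateD(1)] or_left or_right by blast
    show "\<exists>z\<in>canon_states. canon_tri y z \<and> z \<in> ?A"
      if y: "y \<in> canon_states" "Or \<phi> \<psi> \<notin> snd y" for y
    proof -
      \<comment> \<open>An ideal omitting a disjunction omits one of the disjuncts; the principal
        filter of that disjunct is the witness.\<close>
      obtain \<chi> where "\<chi> = \<phi> \<or> \<chi> = \<psi>" "\<chi> \<notin> snd y"
        using y fm_idealD(3)[OF canon_stateD(2)] by blast
      then show ?thesis
        using canon_tri_up[OF y(1)] filter_state[OF fm_filter_up]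
        by (intro bexI[of _ "({\<psi>. \<chi> \<turnstile> \<psi>}, UNIV)"]) (auto intro: fml.refl)
    qed
  qed
  then show ?case
    using Or by (auto simp: canon.cl_def)
next
  case (Neg \<phi>)
  have "(\<forall>y\<in>canon_states. canon_tri y x \<longrightarrow> \<phi> \<notin> fst y) \<longleftrightarrow> Neg \<phi> \<in> fst x"
    if x: "x \<in> canon_states" for x
  proof
    assume "Neg \<phi> \<in> fst x"
    then show "\<forall>y\<in>canon_states. canon_tri y x \<longrightarrow> \<phi> \<notin> fst y"
      using canon_stateD(3) by (auto simp: canon_tri_def)
  next
    \<comment> \<open>Contraposition makes this pair a state. It satisfies \<open>\<phi>\<close> and
      is below \<open>x\<close> unless \<open>Neg \<phi> \<in> fst x\<close>.\<close>
    let ?y = "({\<psi>. \<phi> \<turnstile> \<psi>}, {\<psi>. \<psi> \<turnstile> Neg \<phi>})"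
    have "?y \<in> canon_states"
      by (auto simp: canon_states_def fm_filter_up fm_ideal_down contraposition)
    moreover assume "\<forall>y\<in>canon_states. canon_tri y x \<longrightarrow> \<phi> \<notin> fst y"
    ultimately have "canon_tri ?y x \<Longrightarrow> \<phi> \<notin> fst ?y"
      by blast
    then have "\<not> canon_tri ?y x"
      by (auto simp: fml.refl)
    then show "Neg \<phi> \<in> fst x"
      using fm_filterD(2)[OF canon_stateD(1)[OF x]] by (auto simp: canon_tri_def)
  qed
  then show ?case
    using Neg by auto
next
  case (Box \<phi>)
  have "(\<forall>y\<in>canon_states. canon_R x y \<longrightarrow> \<phi> \<in> fst y) \<longleftrightarrow> Box \<phi> \<in> fst x"
    if x: "x \<in> canon_states" for x
  proof
    assume "\<forall>y\<in>canon_states. canon_R x y \<longrightarrow> \<phi> \<in> fst y"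
    then have "\<phi> \<in> fst (canon_succ x)"
      using canon_succ_state[OF x] canon_R_succ by blast
    then show "Box \<phi> \<in> fst x"
      by (simp add: canon_succ_def)
  qed (auto simp: canon_R_def)
  then show ?case
    using Box by auto
next
  case (Dia \<phi>)
  have "(\<forall>x'\<in>canon_states. canon_tri x' x \<longrightarrow> (\<exists>y'\<in>canon_states. canon_R x' y' \<and>
      (\<exists>y\<in>canon_states. canon_tri y' y \<and> y \<in> canon.truth_set canon_val \<phi>))) \<longleftrightarrow> Dia \<phi> \<in> fst x" (is "?L \<longleftrightarrow> _")
    if x: "x \<in> canon_states" for x
  proof
    \<comment> \<open>Every successor of this state has \<open>\<phi>\<close> in its ideal, so it is
      below no state with \<open>\<phi>\<close> in its filter.\<close>
    let ?x' = "({\<psi>. Top \<turnstile> \<psi>}, {\<psi>. \<psi> \<turnstile> Dia \<phi>})"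
    assume L: ?L
    have "\<not> canon_tri ?x' x"
    proof
      assume "canon_tri ?x' x"
      with L ideal_state[OF fm_ideal_down] obtain y' y
        where "canon_R ?x' y'" "canon_tri y' y" "\<phi> \<in> fst y"
        using Dia by blast
      then show False
        by (auto simp: canon_R_def canon_tri_def intro: fml.refl)
    qed
    then show "Dia \<phi> \<in> fst x"
      using fm_filterD(2)[OF canon_stateD(1)[OF x]] by (auto simp: canon_tri_def)
  next
    assume dia: "Dia \<phi> \<in> fst x"
    show ?L
    proof (intro ballI impI)
      fix x' assume x': "x' \<in> canon_states" "canon_tri x' x"
      \<comment> \<open>Otherwise \<open>Dia \<phi>\<close> would lie in both \<open>snd x'\<close>
        and \<open>fst x\<close>.\<close>
      with dia have "\<phi> \<notin> snd (canon_succ x')"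
        by (auto simp: canon_succ_def canon_tri_def)
      then have "canon_tri (canon_succ x') ({\<psi>. \<phi> \<turnstile> \<psi>}, UNIV)"
        by (rule canon_tri_up[OF canon_succ_state[OF x'(1)]])
      moreover have "({\<psi>. \<phi> \<turnstile> \<psi>}, UNIV) \<in> canon.truth_set canon_val \<phi>"
        by (simp add: Dia filter_state fm_filter_up fml.refl)
      moreover have "({\<psi>. \<phi> \<turnstile> \<psi>}, UNIV) \<in> canon_states"
        by (intro filter_state fm_filter_up)
      ultimately show "\<exists>y'\<in>canon_states. canon_R x' y' \<and>
          (\<exists>y\<in>canon_states. canon_tri y' y \<and> y \<in> canon.truth_set canon_val \<phi>)"
        using canon_succ_state[OF x'(1)] canon_R_succ by blast
    qed
  qed
  then show ?case
    by (simp cong: conj_cong)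
qed

lemma frame_completeness:
  assumes "frame_consequence TYPE(fm set \<times> fm set) \<phi> \<psi>"
  shows "\<phi> \<turnstile> \<psi>"
proof -
  \<comment> \<open>By the truth lemma, the principal filter of \<open>\<phi>\<close> forces
    precisely the consequences of \<open>\<phi>\<close>.\<close>
  let ?x = "({\<chi>. \<phi> \<turnstile> \<chi>}, UNIV)"
  have x: "?x \<in> canon_states"
    by (intro filter_state fm_filter_up)
  then have "canon.forces canon_val ?x \<phi>"
    by (simp add: canon.forces_def truth_lemma fml.refl)
  then have "canon.forces canon_val ?x \<psi>"
    using assms canon_modal_frame canon_additive canon_pseudo_reflexive canon_pseudo_symmetric
      canon_valuation x
    unfolding frame_consequence_def by blast
  then show ?thesis
    by (simp add: canon.forces_def truth_lemma)
qed

theorem theorem6p2: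
  fixes \<phi> \<psi> :: fm
  shows "(\<phi> \<turnstile> \<psi> \<longleftrightarrow> frame_consequence TYPE(fm set \<times> fm set) \<phi> \<psi>) \<and>
         (\<phi> \<turnstile> \<psi> \<longrightarrow> frame_consequence TYPE('a) \<phi> \<psi>)"
  by (intro conjI iffI impI; (rule frame_soundness | rule frame_completeness))

end
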